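(* Let $n\geq 3$ be an integer which is not a power of $2$. Then $h_1(\Delta^{[n]})=n/3$.
   Context: $[n]=\{1,\dots,n\}$ and $\Delta^{[n]}$ denotes the full simplex on the vertex set $[n]$ (all subsets of $[n]$ are simplices). For a finite simplicial complex $X$, let $C^k(X)$ be the $k$-cochains with $\mathbb{Z}_2$-coefficients, and let $\partial^*$ be the coboundary operator. For a cochain $c$, the norm $\|c\|$ is the number of $k$-simplices on which $c$ takes the value $1$. The cosystolic norm of a $k$-cochain $c$ is $\|c\|_{\mathrm{csy}}:=\min_{d\in C^{k-1}(X)}\|c+\partial^* d\|$. The $k$-th Cheeger constant of $X$ is $h_k(X):=\min_c \|\partial^* c\|/\|c\|_{\mathrm{csy}}$, where the minimum is taken over all $c\in C^k(X)$ which are not coboundaries. *)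

theory Defs
  imports Complex_Main "HOL-Library.Z2"
begin

text \<open>
  Abstract finite simplicial complexes. As in the definition of the full simplex, the empty set
  is a simplex (of dimension \<open>-1\<close>) of every nonempty complex; dimensions are integers so that
  \<open>k - 1\<close> is meaningful for all \<open>k\<close>.
\<close>

definition finite_simplicial_complex :: "'a set set \<Rightarrow> bool" where
  "finite_simplicial_complex X \<longleftrightarrow>
     finite X \<and> (\<forall>\<sigma>\<in>X. finite \<sigma>) \<and> (\<forall>\<sigma>\<in>X. \<forall>\<tau>. \<tau> \<subseteq> \<sigma> \<longrightarrow> \<tau> \<in> X)"

definition full_simplex :: "'a set \<Rightarrow> 'a set set" where
  "full_simplex V = Pow V"

definition simplices :: "'a set set \<Rightarrow> int \<Rightarrow> 'a set set" where
  "simplices X k = {\<sigma> \<in> X. int (card \<sigma>) = k + 1}"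

text \<open>
  A \<open>k\<close>-cochain is a function on the \<open>k\<close>-simplices; it is represented by its extension by zero to
  all sets of vertices, so that equality of cochains is equality of functions and each
  cochain group is finite.
\<close>

definition cochains :: "'a set set \<Rightarrow> int \<Rightarrow> ('a set \<Rightarrow> bit) set" where
  "cochains X k = {c. \<forall>\<sigma>. \<sigma> \<notin> simplices X k \<longrightarrow> c \<sigma> = 0}"

definition coboundary :: "'a set set \<Rightarrow> int \<Rightarrow> ('a set \<Rightarrow> bit) \<Rightarrow> ('a set \<Rightarrow> bit)" where
  "coboundary X k c = (\<lambda>\<tau>. if \<tau> \<in> simplices X (k + 1)
     then \<Sum>\<sigma> \<in> {\<sigma> \<in> simplices X k. \<sigma> \<subseteq> \<tau>}. c \<sigma> else 0)"

definition cochain_norm :: "'a set set \<Rightarrow> int \<Rightarrow> ('a set \<Rightarrow> bit) \<Rightarrow> nat" where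
  "cochain_norm X k c = card {\<sigma> \<in> simplices X k. c \<sigma> = 1}"

definition cosystolic_norm :: "'a set set \<Rightarrow> int \<Rightarrow> ('a set \<Rightarrow> bit) \<Rightarrow> nat" where
  "cosystolic_norm X k c =
     Min ((\<lambda>d. cochain_norm X k (\<lambda>\<sigma>. c \<sigma> + coboundary X (k - 1) d \<sigma>)) ` cochains X (k - 1))"

definition coboundaries :: "'a set set \<Rightarrow> int \<Rightarrow> ('a set \<Rightarrow> bit) set" where
  "coboundaries X k = coboundary X (k - 1) ` cochains X (k - 1)"

text \<open>
  For a finite complex the minimum ranges over a finite set and every denominator is positive.
  The value is unspecified if every \<open>k\<close>-cochain is a coboundary.
\<close>

definition cheeger_constant :: "'a set set \<Rightarrow> int \<Rightarrow> real" where
  "cheeger_constant X k =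
     Min ((\<lambda>c. real (cochain_norm X (k + 1) (coboundary X k c)) / real (cosystolic_norm X k c))
          ` (cochains X k - coboundaries X k))"

lemma finite_simplicial_complex_full_simplex:
  "finite V \<Longrightarrow> finite_simplicial_complex (full_simplex V)"
  by (auto simp: finite_simplicial_complex_def full_simplex_def intro: finite_subset)

lemma finite_cochains:
  assumes "finite_simplicial_complex X"
  shows "finite (cochains X k)"
proof -
  have "finite (simplices X k)"
    using assms by (simp add: finite_simplicial_complex_def simplices_def)
  moreover have "finite (UNIV :: bit set)"
  proof (rule finite_subset)
    show "(UNIV :: bit set) \<subseteq> {0, 1}"
      using bit_not_zero_iff by blast
  qed simp
  ultimately have "finite {c :: 'a set \<Rightarrow> bit.
      \<forall>\<sigma>. (\<sigma> \<in> simplices X k \<longrightarrow> c \<sigma> \<in> UNIV) \<and> (\<sigma> \<notin> simplices X k \<longrightarrow> c \<sigma> = 0)}"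
    by (rule finite_set_of_finite_funs)
  then show ?thesis by (simp add: cochains_def)
qed

end

theory Submission
  imports Defs
begin

text \<open>
  Call a triangle odd for a \<open>1\<close>-cochain \<open>c\<close> if the coboundary of \<open>c\<close> is \<open>1\<close> on it.

  Lower bound. Coning off a vertex \<open>v\<close>, that is, adding to \<open>c\<close> the coboundary of the vertex cochain
  \<open>x \<mapsto> c {v, x}\<close>, kills all edges at \<open>v\<close> and leaves \<open>1\<close> exactly on the edges opposite to \<open>v\<close> in
  the odd triangles at \<open>v\<close>. Hence the cosystolic norm is at most the number of odd triangles at
  \<open>v\<close>; summing over all \<open>v\<close> counts each odd triangle three times
  (\<open>cosystolic_norm_le_norm_coboundary\<close>).

  Upper bound. Equality requires every coned-off representative to be of minimal norm. Since \<open>n\<close>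
  is not a power of \<open>2\<close>, it factors as \<open>n = p * q\<close> with \<open>p = 2 * m + 1 \<ge> 3\<close>. For \<open>q = 1\<close> take the
  cochain that is \<open>1\<close> on the pairs of numbers below \<open>p\<close> at distance more than \<open>m\<close>. With the
  numbers placed at the vertices of a regular \<open>p\<close>-gon, its odd triangles are those that contain the
  centre, so every vertex lies on the same number \<open>m * (m + 1) / 2\<close> of them. For general \<open>q\<close>, replace
  each of the \<open>p\<close> points by \<open>q\<close> copies: counts of odd triangles are multiplied by \<open>q ^ 3\<close> and
  norms by \<open>q\<^sup>2\<close> (\<open>norm_coboundary_staircase\<close>).

  What remains is that this cochain cannot be made smaller than \<open>q\<^sup>2 * m * (m + 1) / 2\<close> by
  adding the coboundary of a vertex cochain \<open>s\<close> (\<open>norm_staircase_plus_coboundary\<close>). Let \<open>u i\<close> be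
  the fraction of the copies of \<open>i\<close> on which \<open>s\<close> is \<open>1\<close>, and extend \<open>u\<close> to all natural numbers by
  \<open>u (i + p) = 1 - u i\<close>. The complementation accounts for the long distances: the edges between
  copies of different points that carry the value \<open>1\<close> number \<open>q\<^sup>2 * (D 1 + \<dots> + D m)\<close>, where \<open>D d\<close>
  is the expected number of disagreements between \<open>u\<close> and its shift by \<open>d\<close>, over one period.
  The function \<open>D\<close> is subadditive and satisfies \<open>D (m + 1) = p - D m\<close>, from which
  \<open>2 * (D 1 + \<dots> + D m) \<ge> m * (m + 1)\<close> follows (\<open>antiperiodic_mismatch_sum\<close>).
\<close>

section \<open>Coboundaries in a full simplex\<close>

lemma simplices_full_simplex:
  "simplices (full_simplex V) k = {\<sigma>. \<sigma> \<subseteq> V \<and> int (card \<sigma>) = k + 1}"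
  by (auto simp: simplices_def full_simplex_def)

lemma edges_full_simplex:
  "simplices (full_simplex V) 1 = {{x, y} | x y. x \<in> V \<and> y \<in> V \<and> x \<noteq> y}"
  by (auto simp: simplices_full_simplex card_2_iff nat_eq_iff2)

lemma triangles_full_simplex:
  "simplices (full_simplex V) 2 =
     {{x, y, z} | x y z. x \<in> V \<and> y \<in> V \<and> z \<in> V \<and> x \<noteq> y \<and> x \<noteq> z \<and> y \<noteq> z}"
  by (auto simp: simplices_full_simplex card_3_iff nat_eq_iff2)

lemma bit_add_eq_1_iff: "a + b = (1::bit) \<longleftrightarrow> (a = 1) \<noteq> (b = 1)"
  by (cases a; cases b) auto

lemma coboundary_vertex_cochain:
  assumes "x \<in> V" "y \<in> V" "x \<noteq> y"
  shows "coboundary (full_simplex V) 0 d {x, y} = d {x} + d {y}"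
proof -
  have "{\<sigma> \<in> simplices (full_simplex V) 0. \<sigma> \<subseteq> {x, y}} = {{x}, {y}}"
    using assms by (auto simp: simplices_full_simplex card_1_singleton_iff)
  moreover have "{x, y} \<in> simplices (full_simplex V) (0 + 1)"
    using assms by (auto simp: edges_full_simplex)
  ultimately show ?thesis
    using assms by (simp add: coboundary_def)
qed

lemma coboundary_edge_cochain:
  assumes "x \<in> V" "y \<in> V" "z \<in> V" "x \<noteq> y" "x \<noteq> z" "y \<noteq> z"
  shows "coboundary (full_simplex V) 1 c {x, y, z} = c {x, y} + c {x, z} + c {y, z}"
proof -
  have "{\<sigma> \<in> simplices (full_simplex V) 1. \<sigma> \<subseteq> {x, y, z}} = {{x, y}, {x, z}, {y, z}}"
    using assms by (auto simp: edges_full_simplex doubleton_eq_iff)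
  moreover have "{x, y, z} \<in> simplices (full_simplex V) (1 + 1)"
    using assms by (auto simp: triangles_full_simplex)
  moreover have "sum c {{x, y}, {x, z}, {y, z}} = c {x, y} + (c {x, z} + c {y, z})"
    using assms by (subst sum.insert; auto simp: doubleton_eq_iff)+
  ultimately show ?thesis
    by (simp only: coboundary_def if_True add.assoc)
qed

lemma finite_simplices_full_simplex: "finite V \<Longrightarrow> finite (simplices (full_simplex V) k)"
  by (simp add: simplices_def full_simplex_def)

lemma finite_cochains_full_simplex: "finite V \<Longrightarrow> finite (cochains (full_simplex V) k)"
  by (intro finite_cochains finite_simplicial_complex_full_simplex)

lemma zero_in_cochains: "(\<lambda>_. 0) \<in> cochains X k"
  by (simp add: cochains_def)

lemma cosystolic_norm_le:
  assumes "finite V" "d \<in> cochains (full_simplex V) (k - 1)"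
  shows "cosystolic_norm (full_simplex V) k c
    \<le> cochain_norm (full_simplex V) k (\<lambda>\<sigma>. c \<sigma> + coboundary (full_simplex V) (k - 1) d \<sigma>)"
  unfolding cosystolic_norm_def
  using assms by (intro Min_le finite_imageI finite_cochains_full_simplex) auto

lemma cosystolic_norm_attained:
  assumes "finite V"
  obtains d where "d \<in> cochains (full_simplex V) (k - 1)"
    and "cosystolic_norm (full_simplex V) k c
      = cochain_norm (full_simplex V) k (\<lambda>\<sigma>. c \<sigma> + coboundary (full_simplex V) (k - 1) d \<sigma>)"
proof -
  let ?X = "full_simplex V"
  have "cosystolic_norm ?X k c
      \<in> (\<lambda>d. cochain_norm ?X k (\<lambda>\<sigma>. c \<sigma> + coboundary ?X (k - 1) d \<sigma>)) ` cochains ?X (k - 1)"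
    unfolding cosystolic_norm_def using zero_in_cochains[of ?X "k - 1"]
    by (intro Min_in finite_imageI finite_cochains_full_simplex assms) auto
  then show thesis using that by blast
qed

lemma cosystolic_norm_coboundary:
  assumes "finite V" "c \<in> coboundaries (full_simplex V) k"
  shows "cosystolic_norm (full_simplex V) k c = 0"
proof -
  obtain d where d: "d \<in> cochains (full_simplex V) (k - 1)"
    "c = coboundary (full_simplex V) (k - 1) d"
    using assms by (auto simp: coboundaries_def)
  have "cochain_norm (full_simplex V) k (\<lambda>\<sigma>. c \<sigma> + coboundary (full_simplex V) (k - 1) d \<sigma>) = 0"
    by (simp add: d(2) cochain_norm_def bit_add_eq_1_iff)
  then show ?thesis
    using cosystolic_norm_le[OF assms(1) d(1), of c] by simp
qed

lemma cosystolic_norm_pos: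
  assumes "finite V" "c \<in> cochains (full_simplex V) k" "c \<notin> coboundaries (full_simplex V) k"
  shows "cosystolic_norm (full_simplex V) k c > 0"
proof (rule ccontr)
  let ?X = "full_simplex V"
  assume "\<not> ?thesis"
  then obtain d where d: "d \<in> cochains ?X (k - 1)"
    "cochain_norm ?X k (\<lambda>\<sigma>. c \<sigma> + coboundary ?X (k - 1) d \<sigma>) = 0"
    using cosystolic_norm_attained[OF assms(1), of k c] by (metis not_gr_zero)
  have "c \<sigma> = coboundary ?X (k - 1) d \<sigma>" for \<sigma>
  proof (cases "\<sigma> \<in> simplices ?X k")
    case True
    have "{\<sigma> \<in> simplices ?X k. c \<sigma> + coboundary ?X (k - 1) d \<sigma> = 1} = {}"
      using d(2) finite_simplices_full_simplex[OF assms(1), of k] by (simp add: cochain_norm_def)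
    with True have "c \<sigma> + coboundary ?X (k - 1) d \<sigma> \<noteq> 1" by blast
    then show ?thesis by (simp add: bit_add_eq_1_iff) (metis bit_not_one_iff)
  next
    case False
    then show ?thesis using assms(2) by (simp add: cochains_def coboundary_def)
  qed
  with assms(3) d(1) show False by (auto simp: coboundaries_def)
qed

section \<open>The lower bound: coning off a vertex\<close>

text \<open>
  The right-hand side is the norm of a particular representative, obtained by coning off \<open>v\<close>.
\<close>

lemma cosystolic_norm_le_link:
  assumes "finite V" "v \<in> V"
  shows "cosystolic_norm (full_simplex V) 1 c
    \<le> card {T \<in> simplices (full_simplex V) 2. coboundary (full_simplex V) 1 c T = 1 \<and> v \<in> T}"
    (is "_ \<le> card ?T")
proof -
  let ?X = "full_simplex V"
  \<comment> \<open>The vertex cochain \<open>u \<mapsto> c {v, u}\<close>; it must be \<open>0\<close> at \<open>v\<close> so that the edges at \<open>v\<close> are killed.\<close>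
  define d where "d \<sigma> = (if \<exists>u\<in>V. u \<noteq> v \<and> \<sigma> = {u} then c (insert v \<sigma>) else 0)" for \<sigma>
  have d: "d \<in> cochains ?X (1 - 1)"
    by (auto simp: d_def cochains_def simplices_full_simplex)
  have d_single: "d {u} = (if u = v then 0 else c {v, u})" if "u \<in> V" for u
    using that by (auto simp: d_def)
  let ?S = "{\<sigma> \<in> simplices ?X 1. c \<sigma> + coboundary ?X 0 d \<sigma> = 1}"
  have S: "v \<notin> \<sigma> \<and> insert v \<sigma> \<in> ?T" if \<sigma>: "\<sigma> \<in> ?S" for \<sigma>
  proof -
    obtain x y where xy: "\<sigma> = {x, y}" "x \<in> V" "y \<in> V" "x \<noteq> y"
      using \<sigma> unfolding edges_full_simplex by blast
    have val: "c {x, y} + (d {x} + d {y}) = 1"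
      using \<sigma> xy by (simp add: coboundary_vertex_cochain)
    have "x \<noteq> v" "y \<noteq> v"
      using val xy by (auto simp: d_single bit_add_eq_1_iff insert_commute)
    then have "coboundary ?X 1 c {v, x, y} = 1"
      using val xy assms by (auto simp: coboundary_edge_cochain d_single bit_add_eq_1_iff)
    moreover have "{v, x, y} \<in> simplices ?X 2"
      using xy assms \<open>x \<noteq> v\<close> \<open>y \<noteq> v\<close> by (auto simp: triangles_full_simplex)
    ultimately show ?thesis using xy \<open>x \<noteq> v\<close> \<open>y \<noteq> v\<close> by auto
  qed
  have "card ?S \<le> card ?T"
  proof (rule card_inj_on_le)
    show "inj_on (insert v) ?S"
      using S by (intro inj_onI) (metis insert_ident)
    show "insert v ` ?S \<subseteq> ?T" using S by blast
    show "finite ?T"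
      using finite_simplices_full_simplex[OF assms(1), of 2] by simp
  qed
  then show ?thesis
    using cosystolic_norm_le[OF assms(1) d, of c] by (simp add: cochain_norm_def)
qed

text \<open>
  Sum the previous bound over all vertices; every triangle is met at its three vertices.
\<close>

lemma cosystolic_norm_le_norm_coboundary:
  assumes "finite V"
  shows "card V * cosystolic_norm (full_simplex V) 1 c
    \<le> 3 * cochain_norm (full_simplex V) 2 (coboundary (full_simplex V) 1 c)"
proof -
  let ?X = "full_simplex V"
  let ?A = "{T \<in> simplices ?X 2. coboundary ?X 1 c T = 1}"
  have fin: "finite ?A"
    using finite_simplices_full_simplex[OF assms, of 2] by simp
  have "card V * cosystolic_norm ?X 1 c = (\<Sum>v\<in>V. cosystolic_norm ?X 1 c)" by simp
  also have "\<dots> \<le> (\<Sum>v\<in>V. card {T \<in> ?A. v \<in> T})"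
    using cosystolic_norm_le_link[OF assms, of _ c] by (intro sum_mono) (simp add: conj_assoc)
  also have "\<dots> = 3 * card ?A"
    using assms fin
    by (intro sum_multicount) (auto simp: simplices_full_simplex Int_absorb1 Collect_conj_eq)
  finally show ?thesis by (simp add: cochain_norm_def)
qed

section \<open>An inequality for antiperiodic functions\<close>

text \<open>
  The probability that two independent random bits differ if they are \<open>1\<close> with
  probabilities \<open>a\<close> and \<open>b\<close>. Working with probabilities instead of bits treats all \<open>q\<close> copies of a
  point at once.
\<close>

definition mismatch :: "real \<Rightarrow> real \<Rightarrow> real" where
  "mismatch a b = a + b - 2 * a * b"

text \<open>
  For bits, \<open>a \<noteq> c\<close> forces \<open>a \<noteq> b\<close> or \<open>b \<noteq> c\<close>; the defect in the proof is twice the probability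
  that the middle bit differs from both outer ones.
\<close>

lemma mismatch_triangle:
  assumes "0 \<le> a" "a \<le> 1" "0 \<le> b" "b \<le> 1" "0 \<le> c" "c \<le> 1"
  shows "mismatch a c \<le> mismatch a b + mismatch b c"
proof -
  have "mismatch a b + mismatch b c - mismatch a c = 2 * (b * (1 - a) * (1 - c) + (1 - b) * a * c)"
    by (simp add: mismatch_def algebra_simps)
  also have "\<dots> \<ge> 0" using assms by simp
  finally show ?thesis by simp
qed

lemma sum_shift_periodic:
  fixes g :: "nat \<Rightarrow> 'a::ab_group_add"
  assumes "\<And>i. g (i + p) = g i"
  shows "(\<Sum>i<p. g (i + a)) = (\<Sum>i<p. g i)"
proof (induction a)
  case (Suc a)
  have "(\<Sum>i<p. g (i + Suc a)) = (\<Sum>i<Suc p. g (i + a)) - g a"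
    by (subst sum.lessThan_Suc_shift) simp
  also have "\<dots> = (\<Sum>i<p. g (i + a))"
    using assms[of a] by (simp add: add.commute)
  finally show ?case using Suc by simp
qed simp

text \<open>
  Subadditivity of \<open>D\<close> gives \<open>D d + D (k + 1 - d) \<ge> D (k + 1)\<close>, hence \<open>k * D (k + 1)\<close> is at most
  twice the sum of \<open>D\<close> over \<open>1, \<dots>, k\<close>. If \<open>D m \<le> m\<close>, antiperiodicity makes \<open>D (m + 1) \<ge> m + 1\<close>,
  and \<open>k = m\<close> gives the claim. If \<open>D m > m\<close>, use \<open>k = m - 1\<close> and add
  \<open>2 * D m\<close>, which gives at least \<open>(m + 1) * D m\<close>. Equality holds when \<open>u\<close> is
  constantly \<open>0\<close> on one period, where \<open>D d = d\<close>.
\<close>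

lemma antiperiodic_mismatch_sum:
  fixes u :: "nat \<Rightarrow> real"
  assumes p: "p = 2 * m + 1"
    and anti: "\<And>i. u (i + p) = 1 - u i"
    and unit: "\<And>i. 0 \<le> u i \<and> u i \<le> 1"
  shows "real (m * (m + 1)) \<le> 2 * (\<Sum>d=1..m. \<Sum>i<p. mismatch (u i) (u (i + d)))"
proof -
  define D where "D d = (\<Sum>i<p. mismatch (u i) (u (i + d)))" for d
  have shift: "(\<Sum>i<p. mismatch (u (i + a)) (u (i + a + d))) = D d" for a d
  proof -
    have "mismatch (u (i + p)) (u (i + p + d)) = mismatch (u i) (u (i + d))" for i
    proof -
      have "u (i + p + d) = 1 - u (i + d)"
        using anti[of "i + d"] by (simp add: ac_simps)
      then show ?thesis
        by (simp only: anti mismatch_def) (simp add: algebra_simps)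
    qed
    then show ?thesis
      using sum_shift_periodic[of "\<lambda>i. mismatch (u i) (u (i + d))" p a] by (simp add: D_def)
  qed
  have subadd: "D (a + b) \<le> D a + D b" for a b
  proof -
    have "D (a + b) \<le> (\<Sum>i<p. mismatch (u i) (u (i + a)) + mismatch (u (i + a)) (u (i + a + b)))"
      unfolding D_def using unit by (intro sum_mono) (simp add: mismatch_triangle add.assoc)
    also have "\<dots> = D a + D b"
      by (simp add: sum.distrib shift) (simp add: D_def)
    finally show ?thesis .
  qed
  have compl: "D (m + 1) = p - D m"
  proof -
    have "D m = (\<Sum>i<p. mismatch (u (i + (m + 1))) (u (i + (m + 1) + m)))"
      by (rule shift[symmetric])
    also have "\<dots> = (\<Sum>i<p. 1 - mismatch (u i) (u (i + (m + 1))))"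
    proof (rule sum.cong)
      fix i
      have "i + (m + 1) + m = i + p" using p by simp
      then show "mismatch (u (i + (m + 1))) (u (i + (m + 1) + m)) = 1 - mismatch (u i) (u (i + (m + 1)))"
        by (simp only: anti mismatch_def) (simp add: algebra_simps)
    qed simp
    also have "\<dots> = p - D (m + 1)" by (simp add: sum_subtractf D_def)
    finally show ?thesis by simp
  qed
  have reflect: "real k * D (k + 1) \<le> 2 * (\<Sum>d=1..k. D d)" for k
  proof -
    have "(\<Sum>d=1..k. D (k + 1)) \<le> (\<Sum>d=1..k. D d + D (k + 1 - d))"
      using subadd by (intro sum_mono) (metis atLeastAtMost_iff le_add_diff_inverse trans_le_add1)
    also have "\<dots> = (\<Sum>d=1..k. D d) + (\<Sum>d=1..k. D d)"
      using sum.atLeastAtMost_rev[of D 1 k] by (simp add: sum.distrib)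
    finally show ?thesis by simp
  qed
  have "real (m * (m + 1)) \<le> 2 * (\<Sum>d=1..m. D d)"
  proof (cases "D m \<le> m")
    case True
    then have "real m * real (m + 1) \<le> real m * D (m + 1)"
      using compl p by (intro mult_left_mono) auto
    also note reflect[of m]
    finally show ?thesis by (simp only: of_nat_mult)
  next
    case False
    show ?thesis
    proof (cases m)
      case (Suc k)
      have "real (m * (m + 1)) \<le> (real m + 1) * D m"
        using mult_left_mono[of m "D m" "real m + 1"] False by (simp add: algebra_simps)
      also have "\<dots> = real k * D (k + 1) + 2 * D m"
        by (simp add: Suc algebra_simps)
      also have "\<dots> \<le> 2 * (\<Sum>d=1..k. D d) + 2 * D m"
        using reflect[of k] by simp
      also have "\<dots> = 2 * (\<Sum>d=1..m. D d)" by (simp add: Suc)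
      finally show ?thesis .
    qed simp
  qed
  then show ?thesis by (simp add: D_def)
qed

section \<open>The staircase cochain\<close>

text \<open>
  If \<open>f\<close> is injective with values in \<open>{..<2 * m + 1}\<close>, this is the bipartite graph between the
  values below \<open>m\<close> and the values above \<open>m\<close> whose adjacency matrix is a staircase.
\<close>

definition staircase :: "'a set \<Rightarrow> ('a \<Rightarrow> nat) \<Rightarrow> nat \<Rightarrow> 'a set \<Rightarrow> bit" where
  "staircase V f m \<sigma> = (if \<exists>x\<in>V. \<exists>y\<in>V. \<sigma> = {x, y} \<and> f x + m < f y then 1 else 0)"

lemma staircase_edge:
  assumes "x \<in> V" "y \<in> V"
  shows "staircase V f m {x, y} = 1 \<longleftrightarrow> f x + m < f y \<or> f y + m < f x"
  using assms by (auto simp: staircase_def doubleton_eq_iff)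

lemma staircase_in_cochains: "staircase V f m \<in> cochains (full_simplex V) 1"
  by (auto simp: staircase_def cochains_def edges_full_simplex)

text \<open>
  The function \<open>mismatch\<close> is affine in each argument, so averaging over two fibres can be done inside.
\<close>

lemma sum_mismatch_product:
  assumes "card F = q" "card G = q" "q > 0"
  shows "(\<Sum>x\<in>F. \<Sum>y\<in>G. mismatch (r x) (r y))
    = real (q\<^sup>2) * mismatch ((\<Sum>x\<in>F. r x) / q) ((\<Sum>y\<in>G. r y) / q)"
proof -
  have "2 * ((\<Sum>x\<in>F. r x) * (\<Sum>y\<in>G. r y)) = 2 * (\<Sum>x\<in>F. \<Sum>y\<in>G. r x * r y)"
    by (simp only: sum_product)
  also have "\<dots> = (\<Sum>x\<in>F. \<Sum>y\<in>G. 2 * r x * r y)"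
    by (simp only: sum_distrib_left mult.assoc)
  finally have "(\<Sum>x\<in>F. \<Sum>y\<in>G. mismatch (r x) (r y))
      = q * (\<Sum>x\<in>F. r x) + q * (\<Sum>y\<in>G. r y) - 2 * ((\<Sum>x\<in>F. r x) * (\<Sum>y\<in>G. r y))"
    using assms
    by (simp add: mismatch_def sum.distrib sum_subtractf sum_distrib_left)
  also have "\<dots> = real (q\<^sup>2) * mismatch ((\<Sum>x\<in>F. r x) / q) ((\<Sum>y\<in>G. r y) / q)"
    using assms(3) by (simp add: mismatch_def field_simps power2_eq_square)
  finally show ?thesis .
qed

text \<open>
  Modulo the odd number \<open>p\<close>, each pair of distinct residues has a unique orientation in which it
  is a step \<open>i \<mapsto> i + d\<close> with \<open>1 \<le> d \<le> m\<close>; the step wraps around \<open>p\<close> exactly if the two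
  representatives are more than \<open>m\<close> apart.
\<close>

lemma sum_pairs_by_difference:
  fixes h :: "nat \<Rightarrow> nat \<Rightarrow> 'b::comm_monoid_add"
  assumes p: "p = 2 * m + 1"
  shows "(\<Sum>(i, j) \<in> {(i, j). i < j \<and> j < p}. h i j)
    = (\<Sum>d=1..m. \<Sum>i<p. if i + d < p then h i (i + d) else h (i + d - p) i)"
proof -
  have "(\<Sum>(i, j) \<in> {(i, j). i < j \<and> j < p}. h i j)
    = (\<Sum>(d, i) \<in> {1..m} \<times> {..<p}. if i + d < p then h i (i + d) else h (i + d - p) i)"
    by (rule sum.reindex_bij_witness
        [where j = "\<lambda>(i, j). if j \<le> i + m then (j - i, i) else (p - (j - i), j)"
          and i = "\<lambda>(d, i). if i + d < p then (i, i + d) else (i + d - p, i)"])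
      (use p in \<open>auto split: if_splits\<close>)
  then show ?thesis by (simp add: sum.cartesian_product)
qed

lemma six_times_sum_squares: "6 * (\<Sum>t=1..m. t * t) = m * (m + 1) * (2 * m + (1::nat))"
  by (induction m) (auto simp: algebra_simps)

text \<open>
  The vertex set as a blow-up of the \<open>p\<close> points \<open>{..<p}\<close>, each replaced by a fibre of \<open>q\<close> vertices.
\<close>

locale equipartition =
  fixes V :: "'a set" and f :: "'a \<Rightarrow> nat" and p q m :: nat
  assumes finite_V: "finite V"
    and p: "p = 2 * m + 1"
    and f_less: "x \<in> V \<Longrightarrow> f x < p"
    and card_fibre: "i < p \<Longrightarrow> card {x \<in> V. f x = i} = q"
    and q_pos: "q > 0"
begin

text \<open>
  No representative is smaller than the staircase. Edges inside a fibre are discarded; the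
  others are counted fibre pair by fibre pair. Fibres at most \<open>m\<close> apart contribute the mismatch of
  the two fractions, fibres further apart its complement, which is what the antiperiodic extension
  \<open>u\<close> produces for a step that wraps around.
\<close>

lemma norm_staircase_plus_coboundary:
  "q\<^sup>2 * (m * (m + 1)) \<le> 2 * cochain_norm (full_simplex V) 1
     (\<lambda>\<sigma>. staircase V f m \<sigma> + coboundary (full_simplex V) 0 d \<sigma>)"
proof -
  let ?X = "full_simplex V"
  define c where "c = (\<lambda>\<sigma>. staircase V f m \<sigma> + coboundary ?X 0 d \<sigma>)"
  define S where "S = {(x, y). x \<in> V \<and> y \<in> V \<and> f x < f y}"
  define F where "F i = {x \<in> V. f x = i}" for i
  define r where "r x = (of_bool (d {x} = 1) :: real)" for x
  define w where "w x y = (if f x + m < f y then 1 - mismatch (r x) (r y) else mismatch (r x) (r y))"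
    for x y
  define a where "a i = (\<Sum>x\<in>F i. r x) / q" for i
  define h where "h i j = (if i + m < j then 1 - mismatch (a i) (a j) else mismatch (a i) (a j))"
    for i j
  define u where "u k = (if even (k div p) then a (k mod p) else 1 - a (k mod p))" for k
  have fin_S: "finite S"
    by (rule finite_subset[of _ "V \<times> V"]) (auto simp: S_def finite_V)
  have w: "of_bool (c {x, y} = 1) = w x y" if "(x, y) \<in> S" for x y
  proof -
    have "x \<in> V" "y \<in> V" "f x < f y" "x \<noteq> y" using that by (auto simp: S_def)
    then have "c {x, y} = 1 \<longleftrightarrow> (f x + m < f y) \<noteq> ((d {x} = 1) \<noteq> (d {y} = 1))"
      by (simp add: c_def coboundary_vertex_cochain bit_add_eq_1_iff staircase_edge)
    then show ?thesis by (simp add: w_def r_def mismatch_def)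
  qed
  have unit: "0 \<le> a i \<and> a i \<le> 1" if "i < p" for i
  proof -
    have "(\<Sum>x\<in>F i. r x) \<le> (\<Sum>x\<in>F i. 1)" by (intro sum_mono) (simp add: r_def)
    also have "\<dots> = q" using card_fibre[OF that] by (simp add: F_def)
    finally show ?thesis using q_pos by (auto simp: a_def r_def intro!: divide_nonneg_nonneg sum_nonneg)
  qed
  have fibres: "(\<Sum>(x, y) \<in> F i \<times> F j. w x y) = q\<^sup>2 * h i j" if "i < p" "j < p" for i j
  proof -
    have cF: "card (F i) = q" "card (F j) = q" using card_fibre that by (auto simp: F_def)
    have "(\<Sum>(x, y) \<in> F i \<times> F j. w x y) = (\<Sum>x\<in>F i. \<Sum>y\<in>F j.
        if i + m < j then 1 - mismatch (r x) (r y) else mismatch (r x) (r y))"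
      by (simp add: sum.cartesian_product[symmetric] w_def F_def)
    also have "\<dots> = q\<^sup>2 * h i j"
      using sum_mismatch_product[OF cF q_pos, of r] cF
      by (simp add: h_def a_def sum_subtractf power2_eq_square algebra_simps)
    finally show ?thesis .
  qed
  have per: "u (i + p) = 1 - u i" for i
  proof -
    have "p > 0" using p by simp
    then show ?thesis by (simp add: u_def)
  qed
  have u01: "0 \<le> u i \<and> u i \<le> 1" for i
    using unit[of "i mod p"] p by (simp add: u_def)
  have small: "u i = a i" if "i < p" for i using that by (simp add: u_def)
  have "real (q\<^sup>2 * (m * (m + 1))) \<le> real (q\<^sup>2) * (2 * (\<Sum>d=1..m. \<Sum>i<p. mismatch (u i) (u (i + d))))"
    using antiperiodic_mismatch_sum[of p m u, OF p per u01] unfolding of_nat_mult by (intro mult_left_mono) auto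
  also have "(\<Sum>d=1..m. \<Sum>i<p. mismatch (u i) (u (i + d)))
      = (\<Sum>d=1..m. \<Sum>i<p. if i + d < p then h i (i + d) else h (i + d - p) i)"
  proof (intro sum.cong refl)
    fix d i assume di: "d \<in> {1..m}" "i \<in> {..<p}"
    show "mismatch (u i) (u (i + d)) = (if i + d < p then h i (i + d) else h (i + d - p) i)"
    proof (cases "i + d < p")
      case True
      then show ?thesis using di by (simp add: small h_def)
    next
      case False
      define j where "j = i + d - p"
      have j: "i + d = j + p" "j < p" "j + m < i" using False di p by (auto simp: j_def)
      have "u (i + d) = 1 - a j" using j per[of j] small[of j] by simp
      then have "mismatch (u i) (u (i + d)) = mismatch (a i) (1 - a j)"
        using di(2) by (simp add: small)
      also have "\<dots> = 1 - mismatch (a j) (a i)"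
        by (simp add: mismatch_def algebra_simps)
      also have "\<dots> = h (i + d - p) i"
        using j(3) by (simp add: h_def flip: j_def)
      finally show ?thesis using False by simp
    qed
  qed
  also have "\<dots> = (\<Sum>(i, j) \<in> {(i, j). i < j \<and> j < p}. h i j)"
    by (rule sum_pairs_by_difference[OF p, symmetric])
  also have "q\<^sup>2 * (2 * \<dots>) = 2 * (\<Sum>(i, j) \<in> {(i, j). i < j \<and> j < p}. q\<^sup>2 * h i j)"
    by (simp add: sum_distrib_left split_def mult.left_commute)
  also have "(\<Sum>(i, j) \<in> {(i, j). i < j \<and> j < p}. q\<^sup>2 * h i j)
      = (\<Sum>(i, j) \<in> {(i, j). i < j \<and> j < p}. \<Sum>(x, y) \<in> F i \<times> F j. w x y)"
    by (intro sum.cong) (auto simp: fibres)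
  also have "\<dots> = (\<Sum>ij \<in> {(i, j). i < j \<and> j < p}.
      \<Sum>(x, y) \<in> {xy \<in> S. (case xy of (x, y) \<Rightarrow> (f x, f y)) = ij}. w x y)"
    by (intro sum.cong) (auto simp: S_def F_def intro!: sum.cong)
  also have "\<dots> = (\<Sum>(x, y)\<in>S. w x y)"
  proof (rule sum.group[OF fin_S])
    show "finite {(i, j). i < j \<and> j < p}"
      by (rule finite_subset[of _ "{..<p} \<times> {..<p}"]) auto
  qed (auto simp: S_def f_less)
  also have "\<dots> = (\<Sum>(x, y)\<in>S. of_bool (c {x, y} = 1))"
    by (intro sum.cong) (auto simp: w)
  also have "\<dots> = card {(x, y) \<in> S. c {x, y} = 1}"
    using fin_S by (simp add: split_def Int_def conj_commute)
  also have "\<dots> \<le> cochain_norm ?X 1 c"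
    unfolding cochain_norm_def
  proof (intro of_nat_mono card_inj_on_le)
    show "inj_on (\<lambda>(x, y). {x, y}) {(x, y) \<in> S. c {x, y} = 1}"
      by (auto simp: inj_on_def S_def doubleton_eq_iff)
    show "(\<lambda>(x, y). {x, y}) ` {(x, y) \<in> S. c {x, y} = 1} \<subseteq> {\<sigma> \<in> simplices ?X 1. c \<sigma> = 1}"
      unfolding edges_full_simplex by (fastforce simp: S_def)
  qed (simp add: finite_simplices_full_simplex finite_V)
  finally show ?thesis
    unfolding c_def by linarith
qed

text \<open>
  A triangle is odd precisely if its vertices lie over \<open>i < j < k\<close> with \<open>k - i > m\<close> but
  \<open>j - i \<le> m\<close> and \<open>k - j \<le> m\<close>. Put \<open>t = p - (k - i)\<close>, which runs from \<open>1\<close> to \<open>m\<close>. For each \<open>t\<close> there are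
  \<open>t\<close> positions for \<open>i\<close>, and \<open>t\<close> positions for \<open>j\<close> between \<open>k - m\<close> and \<open>i + m\<close>. This gives a sum of
  squares, and a factor \<open>q\<close> for each of the three vertices.
\<close>

lemma norm_coboundary_staircase:
  "6 * cochain_norm (full_simplex V) 2 (coboundary (full_simplex V) 1 (staircase V f m))
    \<le> q ^ 3 * (m * (m + 1) * p)"
proof -
  let ?X = "full_simplex V" and ?c = "staircase V f m"
  define F where "F i = {x \<in> V. f x = i}" for i
  define P where "P = {(i, j, k). k < p \<and> i + m < k \<and> k \<le> j + m \<and> j \<le> i + m}"
  define Q where "Q = (SIGMA t:P. case t of (i, j, k) \<Rightarrow> F i \<times> F j \<times> F k)"
  let ?R = "SIGMA t:{1..m}. {..<t} \<times> {..<t}"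
  have P_sub: "P \<subseteq> (\<lambda>(t, i, l). (i, i + m - l, i + p - t)) ` ?R"
  proof clarify
    fix i j k assume "(i, j, k) \<in> P"
    then show "(i, j, k) \<in> (\<lambda>(t, i, l). (i, i + m - l, i + p - t)) ` ?R"
      by (intro image_eqI[of _ _ "(i + p - k, i, i + m - j)"]) (auto simp: P_def p)
  qed
  have "card P \<le> card ?R" by (rule surj_card_le[OF _ P_sub]) simp
  also have "card ?R = (\<Sum>t=1..m. t * t)" by simp
  finally have card_P: "card P \<le> (\<Sum>t=1..m. t * t)" .
  have fin_P: "finite P" by (rule finite_subset[OF P_sub]) simp
  have "card (case t of (i, j, k) \<Rightarrow> F i \<times> F j \<times> F k) = q ^ 3" if "t \<in> P" for t
    using that p by (auto simp: P_def F_def card_cartesian_product card_fibre power3_eq_cube)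
  then have card_Q: "card Q = card P * q ^ 3"
    using fin_P finite_V by (simp add: Q_def card_SigmaI F_def split: prod.split)
  have fin_Q: "finite Q"
    using fin_P finite_V by (auto simp: Q_def F_def)
  have "{T \<in> simplices ?X 2. coboundary ?X 1 ?c T = 1} \<subseteq> (\<lambda>(_, x, y, z). {x, y, z}) ` Q"
  proof clarify
    fix T assume T: "T \<in> simplices ?X 2" "coboundary ?X 1 ?c T = 1"
    obtain x y z where xyz: "T = {x, y, z}" "x \<in> V" "y \<in> V" "z \<in> V" "x \<noteq> y" "x \<noteq> z" "y \<noteq> z"
      "f x \<le> f y" "f y \<le> f z"
    proof -
      obtain x y z where *: "T = {x, y, z}" "x \<in> V" "y \<in> V" "z \<in> V" "x \<noteq> y" "x \<noteq> z" "y \<noteq> z"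
        using T(1) unfolding triangles_full_simplex by blast
      have eqs: "T = {x, z, y}" "T = {y, x, z}" "T = {y, z, x}" "T = {z, x, y}" "T = {z, y, x}"
        using *(1) by blast+
      show thesis
        using nat_le_linear[of "f x" "f y"] nat_le_linear[of "f y" "f z"] nat_le_linear[of "f x" "f z"]
          that[of x y z] that[of x z y] that[of y x z] that[of y z x] that[of z x y] that[of z y x]
          * eqs by argo
    qed
    have "?c {x, y} + ?c {x, z} + ?c {y, z} = 1"
      using T(2) unfolding xyz(1) coboundary_edge_cochain[OF xyz(2-7)] .
    moreover have "?c {x, y} = 1 \<longleftrightarrow> f x + m < f y" "?c {x, z} = 1 \<longleftrightarrow> f x + m < f z"
      "?c {y, z} = 1 \<longleftrightarrow> f y + m < f z"
      using xyz(2-4,8,9) by (auto simp: staircase_edge)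
    ultimately have "((f x + m < f y) \<noteq> (f x + m < f z)) \<noteq> (f y + m < f z)"
      by (simp only: bit_add_eq_1_iff simp_thms)
    \<comment> \<open>The alternative is that all three edges carry \<open>1\<close>; two gaps above \<open>m\<close> do not fit below \<open>p = 2 * m + 1\<close>.\<close>
    then have "f x + m < f z \<and> f z \<le> f y + m \<and> f y \<le> f x + m"
      using xyz(8,9) f_less[OF xyz(4)] p by presburger
    then have "(f x, f y, f z) \<in> P"
      using f_less[OF xyz(4)] by (simp add: P_def)
    then show "T \<in> (\<lambda>(_, x, y, z). {x, y, z}) ` Q"
      using xyz by (intro image_eqI[of _ _ "((f x, f y, f z), x, y, z)"]) (auto simp: Q_def F_def)
  qed
  then have "cochain_norm ?X 2 (coboundary ?X 1 ?c) \<le> card Q"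
    unfolding cochain_norm_def by (rule surj_card_le[OF fin_Q])
  also have "\<dots> \<le> (\<Sum>t=1..m. t * t) * q ^ 3"
    unfolding card_Q using card_P by simp
  finally have "6 * cochain_norm ?X 2 (coboundary ?X 1 ?c) \<le> 6 * (\<Sum>t=1..m. t * t) * q ^ 3"
    by simp
  also have "\<dots> = q ^ 3 * (m * (m + 1) * p)"
    unfolding six_times_sum_squares p by (simp only: mult.commute)
  finally show ?thesis .
qed

text \<open>
  The two preceding bounds are in the ratio \<open>q * p / 3\<close>, so the staircase attains the lower bound
  for the Cheeger constant.
\<close>

lemma staircase_optimal:
  "3 * cochain_norm (full_simplex V) 2 (coboundary (full_simplex V) 1 (staircase V f m))
    \<le> p * q * cosystolic_norm (full_simplex V) 1 (staircase V f m)"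
proof -
  let ?X = "full_simplex V" and ?c = "staircase V f m"
  have "q\<^sup>2 * (m * (m + 1)) \<le> 2 * cosystolic_norm ?X 1 ?c"
    using cosystolic_norm_attained[OF finite_V, of 1 ?c] norm_staircase_plus_coboundary
    by (metis diff_self)
  then have "p * q * (q\<^sup>2 * (m * (m + 1))) \<le> p * q * (2 * cosystolic_norm ?X 1 ?c)"
    by (rule mult_le_mono2)
  moreover have "p * q * (q\<^sup>2 * (m * (m + 1))) = q ^ 3 * (m * (m + 1) * p)"
    by (simp only: power3_eq_cube power2_eq_square ac_simps)
  ultimately have "6 * cochain_norm ?X 2 (coboundary ?X 1 ?c)
      \<le> p * q * (2 * cosystolic_norm ?X 1 ?c)"
    using norm_coboundary_staircase by linarith
  then show ?thesis by linarith
qed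

lemma cosystolic_norm_staircase_pos:
  assumes "m > 0"
  shows "cosystolic_norm (full_simplex V) 1 (staircase V f m) > 0"
proof -
  have "0 < q\<^sup>2 * (m * (m + 1))" using assms q_pos by simp
  also have "\<dots> \<le> 2 * cosystolic_norm (full_simplex V) 1 (staircase V f m)"
    using cosystolic_norm_attained[OF finite_V, of 1 "staircase V f m"]
      norm_staircase_plus_coboundary by (metis diff_self)
  finally show ?thesis by simp
qed

end

section \<open>The Cheeger constant\<close>

lemma odd_divisor_of_non_power_of_2:
  fixes n :: nat
  assumes "n > 0" "\<nexists>k. n = 2 ^ k"
  obtains m q where "n = (2 * m + 1) * q" "m > 0" "q > 0"
proof -
  have "\<exists>m q. n = (2 * m + 1) * q \<and> m > 0 \<and> q > 0"
    using assms
  proof (induction n rule: less_induct)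
    case (less n)
    show ?case
    proof (cases "even n")
      case True
      then obtain k where k: "n = 2 * k" by blast
      have "\<nexists>l. k = 2 ^ l"
      proof
        assume "\<exists>l. k = 2 ^ l"
        then obtain l where "n = 2 ^ Suc l" using k by auto
        with less.prems(2) show False by blast
      qed
      moreover have "k < n" "k > 0" using less.prems(1) k by simp_all
      ultimately obtain m q where "k = (2 * m + 1) * q" "m > 0" "q > 0"
        using less.IH by blast
      then have "n = (2 * m + 1) * (2 * q) \<and> m > 0 \<and> 2 * q > 0" using k by simp
      then show ?thesis by blast
    next
      case False
      then obtain m where m: "n = 2 * m + 1" by (blast elim: oddE)
      have "n \<noteq> 2 ^ 0" using less.prems(2) by blast
      then have "n = (2 * m + 1) * 1 \<and> m > 0 \<and> (1::nat) > 0" using m by simp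
      then show ?thesis by blast
    qed
  qed
  then show thesis using that by blast
qed

text \<open>
  Cut the vertices into consecutive blocks of \<open>q\<close>; the shift by \<open>1\<close> is there because they are
  numbered from \<open>1\<close>.
\<close>

lemma equipartition_blocks:
  assumes "p = 2 * m + 1" "q > 0"
  shows "equipartition {1..p * q} (\<lambda>x. (x - 1) div q) p q m"
proof
  show "(x - 1) div q < p" if "x \<in> {1..p * q}" for x
    using that assms by (auto simp: div_less_iff_less_mult)
  fix i assume i: "i < p"
  then have le: "(i + 1) * q \<le> p * q" by (intro mult_le_mono1) simp
  have block: "(x - 1) div q = i \<longleftrightarrow> i * q \<le> x - 1 \<and> x - 1 < i * q + q" for x
    using less_eq_div_iff_mult_less_eq[of q i "x - 1"] div_less_iff_less_mult[of q "x - 1" "i + 1"]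
      assms(2) by auto
  have "{x \<in> {1..p * q}. (x - 1) div q = i} = {i * q + 1..i * q + q}"
    unfolding block using assms(2) le by auto
  then show "card {x \<in> {1..p * q}. (x - 1) div q = i} = q" by simp
qed (use assms in auto)

theorem corollary4p3:
  fixes n :: nat
  assumes "n \<ge> 3"
    and "\<not> (\<exists>m::nat. n = 2 ^ m)"
  shows "cheeger_constant (full_simplex {1..n}) 1 = real n / 3"
proof -
  let ?X = "full_simplex {1..n}"
  let ?ratio = "\<lambda>c. real (cochain_norm ?X 2 (coboundary ?X 1 c)) / real (cosystolic_norm ?X 1 c)"
  obtain m q where mq: "n = (2 * m + 1) * q" "m > 0" "q > 0"
    using odd_divisor_of_non_power_of_2[of n] assms by auto
  define c where "c = staircase {1..n} (\<lambda>x. (x - 1) div q) m"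
  interpret equipartition "{1..n}" "\<lambda>x. (x - 1) div q" "2 * m + 1" q m
    unfolding mq(1) using mq(3) by (intro equipartition_blocks) auto
  have lower: "real n / 3 \<le> ?ratio b" if "b \<in> cochains ?X 1 - coboundaries ?X 1" for b
  proof -
    have "cosystolic_norm ?X 1 b > 0"
      using that by (intro cosystolic_norm_pos) auto
    moreover have "n * cosystolic_norm ?X 1 b \<le> 3 * cochain_norm ?X 2 (coboundary ?X 1 b)"
      using cosystolic_norm_le_norm_coboundary[of "{1..n}" b] by simp
    then have "real n * cosystolic_norm ?X 1 b \<le> 3 * cochain_norm ?X 2 (coboundary ?X 1 b)"
      by (metis of_nat_le_iff of_nat_mult of_nat_numeral)
    ultimately show ?thesis by (simp add: field_simps)
  qed
  have pos: "cosystolic_norm ?X 1 c > 0"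
    unfolding c_def using mq(2) by (rule cosystolic_norm_staircase_pos)
  then have c: "c \<in> cochains ?X 1 - coboundaries ?X 1"
    using cosystolic_norm_coboundary[of "{1..n}" c 1] staircase_in_cochains by (auto simp: c_def)
  have "3 * cochain_norm ?X 2 (coboundary ?X 1 c) \<le> n * cosystolic_norm ?X 1 c"
    unfolding c_def using staircase_optimal mq(1) by simp
  then have "3 * real (cochain_norm ?X 2 (coboundary ?X 1 c)) \<le> real n * cosystolic_norm ?X 1 c"
    by (metis of_nat_le_iff of_nat_mult of_nat_numeral)
  then have upper: "?ratio c \<le> real n / 3"
    using pos by (simp add: field_simps)
  have "Min (?ratio ` (cochains ?X 1 - coboundaries ?X 1)) = real n / 3"
  proof (rule Min_eqI)
    show "real n / 3 \<in> ?ratio ` (cochains ?X 1 - coboundaries ?X 1)"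
      using c upper lower[OF c] by (intro image_eqI[of _ _ c]) auto
  qed (use lower finite_cochains_full_simplex[of "{1..n}" 1] in auto)
  then show ?thesis by (simp add: cheeger_constant_def)
qed

end
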